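(* The orthonormal polynomial sequence $\{p_n^{[2]}(x)\}_{n\ge0}$ with respect to $(x-c)^2d\mu$ satisfies the three term recurrence relation $$\sqrt{\tau_{n+1}}\,p_{n+1}^{[2]}(x)=(x-\kappa_n)\,p_n^{[2]}(x)-\sqrt{\tau_n}\,p_{n-1}^{[2]}(x),\qquad n\ge0,$$ with $p_{-1}^{[2]}(x)=0$, $p_0^{[2]}(x)=1/\sqrt{\tau_0}$, where $$\kappa_n=\left(\beta_n+\gamma_n\frac{d_{n-1}}{e_{n-1}}\right)e_n\left(\frac{r_n^{[2]}}{r_n}\right)^2-d_n\left(\frac{r_n^{[2]}}{r_{n+1}}\right)^2$$ $$=\beta_n+\gamma_n\left(\left(\frac{r_{n-1}^{[2]}}{r_{n-1}}\right)^2\frac{r_n}{r_{n+1}}\frac{p_{n+1}(c)}{p_n(c)}+\frac{r_n}{r_{n-1}}\frac{p_{n-1}(c)}{p_n(c)}\right)-\left(\frac{r_n^{[2]}}{r_{n+1}}\frac{r_n^{[2]}}{r_{n+2}}\frac{p_{n+2}(c)}{p_{n+1}(c)}+\frac{r_n}{r_{n+1}}\frac{p_n(c)}{p_{n+1}(c)}\right),$$ $$\tau_n=\left(\frac{r_{n-1}^{[2]}}{r_n^{[2]}}\right)^2>0,$$ and $$e_n=\left(\frac{r_n}{r_n^{[2]}}\right)^2>0,\qquad d_n=\frac{r_{n+1}}{r_{n+2}}\frac{p_{n+2}(c)}{p_{n+1}(c)}+\left(\frac{r_n}{r_n^{[2]}}\right)^2\frac{r_{n+1}}{r_n}\frac{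p_n(c)}{p_{n+1}(c)}.$$
   Context: $\mu$ is a positive Borel measure with infinite support contained in an interval $E\subseteq\mathbb{R}$ (bounded or unbounded), with all moments finite, and $c\in\mathbb{R}\setminus E$. $\{P_n\}_{n\ge0}$ are the monic orthogonal polynomials for $\int_E fg\,d\mu$, with $xP_n=P_{n+1}+\beta_nP_n+\gamma_nP_{n-1}$ ($n\ge0$, $P_{-1}=0$). $p_n(x)=r_nx^n+\cdots$, $r_n>0$, are the orthonormal polynomials with respect to $\mu$, and $p_n^{[2]}(x)=r_n^{[2]}x^n+\cdots$, $r_n^{[2]}>0$, the orthonormal polynomials with respect to $(x-c)^2d\mu$. For $n=0$, the terms multiplied by $\gamma_0$ in $\kappa_0$ are read as $0$, and $\tau_0=\int_E(x-c)^2d\mu(x)$ (i.e. $r_{-1}^{[2]}=1$). *)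

theory Defs
  imports "HOL-Analysis.Analysis" "HOL-Computational_Algebra.Polynomial"
begin

(* The (closed) topological support. *)
definition measure_support :: "'a::topological_space measure \<Rightarrow> 'a set" where
  "measure_support M = {x. \<forall>U. open U \<longrightarrow> x \<in> U \<longrightarrow> emeasure M U > 0}"

definition finite_moments :: "real measure \<Rightarrow> real set \<Rightarrow> bool" where
  "finite_moments M E \<longleftrightarrow> (\<forall>k::nat. set_integrable M E (\<lambda>x. x ^ k))"

(* The case m = n is not constrained: for a measure with infinite support the integral of
   (P n)^2 is automatically positive. *)
definition monic_orthogonal_polys ::
    "real measure \<Rightarrow> real set \<Rightarrow> (nat \<Rightarrow> real poly) \<Rightarrow> bool" where
  "monic_orthogonal_polys M E P \<longleftrightarrow>
     (\<forall>n. degree (P n) = n \<and> lead_coeff (P n) = 1) \<and>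
     (\<forall>m n. m \<noteq> n \<longrightarrow> (LINT x:E|M. poly (P m) x * poly (P n) x) = 0)"

definition orthonormal_polys ::
    "real measure \<Rightarrow> real set \<Rightarrow> (nat \<Rightarrow> real poly) \<Rightarrow> bool" where
  "orthonormal_polys M E p \<longleftrightarrow>
     (\<forall>n. degree (p n) = n \<and> lead_coeff (p n) > 0) \<and>
     (\<forall>m n. (LINT x:E|M. poly (p m) x * poly (p n) x) = (if m = n then 1 else 0))"

(* The measure (x - c)^2 dM. *)
definition christoffel2 :: "real \<Rightarrow> real measure \<Rightarrow> real measure" where
  "christoffel2 c M = density M (\<lambda>x. ennreal ((x - c)\<^sup>2))"

end

(* Expand (x - c)^2 p2_n in the p_k. By orthogonality only k = n, n+1, n+2 occur; the outer two
   coefficients come from leading coefficients, and the middle one from evaluating at c, where the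
   left side vanishes. This needs p_n(c) \<noteq> 0: otherwise p_n = (x - c) q and the integral of
   (x - c) q^2 = p_n q vanishes, although x - c has constant sign on the interval E. Multiplying the
   three term recurrence of p2 by (x - c)^2 and pairing it with p_n then expresses kappa_n. *)
theory Submission
  imports Defs
begin

section \<open>Orthogonal polynomials for a linear functional\<close>

text \<open>Linearity is all that the algebra below uses. Working with an abstract functional lets
  the same lemmas serve integration against \<open>\<mu>\<close> and against the weighted measure,
  with integrability settled only once.\<close>

locale poly_functional =
  fixes L :: "real poly \<Rightarrow> real"
  assumes L_add: "L (f + g) = L f + L g"
    and L_smult: "L (smult a f) = a * L f"
begin

lemma L_0 [simp]: "L 0 = 0"
  using L_smult[of 0 0] by simp

lemma L_diff: "L (f - g) = L f - L g"
  using L_add[of f "smult (-1) g"] L_smult[of "-1" g] by simp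

text \<open>Induction on the degree of \<open>g\<close>: subtracting the multiple of
  \<open>q m\<close> that cancels its leading term lowers the degree, and that multiple is itself
  orthogonal to \<open>q n\<close>. No normalisation enters, so this serves both the monic and the
  orthonormal sequence.\<close>

lemma L_lower_degree:
  assumes deg: "\<And>k. degree (q k) = k"
    and orth: "\<And>m n. m \<noteq> n \<Longrightarrow> L (q m * q n) = 0"
    and nz: "\<And>k. q k \<noteq> 0"
    and "degree g < n"
  shows "L (g * q n) = 0"
  using \<open>degree g < n\<close>
proof (induction "degree g" arbitrary: g rule: less_induct)
  case less
  define m where "m = degree g"
  define h where "h = g - smult (lead_coeff g / lead_coeff (q m)) (q m)"
  have "lead_coeff (q m) \<noteq> 0"
    using nz by simp
  then have h_m: "coeff h m = 0"
    by (simp add: h_def m_def deg)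
  have h_deg: "degree h \<le> m"
    unfolding h_def by (intro degree_diff_le) (simp_all add: m_def deg)
  have "L (h * q n) = 0"
  proof (cases "h = 0")
    case False
    then have "degree h < degree g"
      using h_m h_deg eq_zero_or_degree_less m_def by auto
    then show ?thesis
      using less by auto
  qed simp
  moreover have "L (q m * q n) = 0"
    using less.prems orth m_def by simp
  moreover have "g * q n = h * q n + smult (lead_coeff g / lead_coeff (q m)) (q m * q n)"
    by (simp add: h_def algebra_simps)
  ultimately show ?case
    by (simp add: L_add L_smult)
qed

end

locale orthonormal_functional = poly_functional +
  fixes q :: "nat \<Rightarrow> real poly"
  assumes degree_q: "degree (q n) = n"
    and lead_coeff_q: "lead_coeff (q n) > 0"
    and orthonormal_q: "L (q m * q n) = (if m = n then 1 else 0)"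
begin

lemma q_nonzero [simp]: "q n \<noteq> 0"
  using lead_coeff_q[of n] by auto

lemma L_q_lower: "degree g < n \<Longrightarrow> L (g * q n) = 0"
  by (rule L_lower_degree) (simp_all add: degree_q orthonormal_q)

text \<open>Removing the multiple of \<open>q n\<close> that cancels the coefficient at
  \<open>n\<close> leaves a polynomial of lower degree, orthogonal to \<open>q n\<close>. Every
  ratio of leading coefficients below comes from here.\<close>

lemma L_q_same_degree:
  assumes "degree g \<le> n"
  shows "L (g * q n) = coeff g n / lead_coeff (q n)"
proof -
  define a where "a = coeff g n / lead_coeff (q n)"
  define h where "h = g - smult a (q n)"
  have "lead_coeff (q n) \<noteq> 0"
    by simp
  then have h_n: "coeff h n = 0"
    by (simp add: h_def a_def degree_q)
  have "degree h \<le> n"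
    unfolding h_def using assms by (intro degree_diff_le) (simp_all add: degree_q)
  then have "L (h * q n) = 0"
    using h_n L_q_lower[of h n] eq_zero_or_degree_less[of h n] by auto
  moreover have "g * q n = h * q n + smult a (q n * q n)"
    by (simp add: h_def algebra_simps)
  ultimately show ?thesis
    by (simp add: L_add L_smult orthonormal_q flip: a_def)
qed

lemma eq_0_if_orthogonal:
  assumes "\<And>k. k \<le> degree f \<Longrightarrow> L (f * q k) = 0"
  shows "f = 0"
  using L_q_same_degree[of f "degree f"] assms[of "degree f"] by simp

text \<open>The tool for all expansions: both sides need only be paired with each
  \<open>q k\<close>. Nondegeneracy follows from testing the difference against the
  \<open>q k\<close> of its own degree, which reads off its leading coefficient.\<close>

lemma eq_if_L_eq:
  assumes "degree f \<le> n" "degree g \<le> n" "\<And>k. k \<le> n \<Longrightarrow> L (f * q k) = L (g * q k)"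
  shows "f = g"
proof -
  have "f - g = 0"
  proof (rule eq_0_if_orthogonal)
    fix k assume "k \<le> degree (f - g)"
    then have "k \<le> n"
      using degree_diff_le[OF assms(1,2)] by simp
    then show "L ((f - g) * q k) = 0"
      using assms(3) by (simp add: left_diff_distrib L_diff)
  qed
  then show ?thesis
    by simp
qed

lemma monic_orthogonal_eq:
  assumes deg: "\<And>n. degree (P n) = n" and lead: "\<And>n. lead_coeff (P n) = 1"
    and orth: "\<And>m n. m \<noteq> n \<Longrightarrow> L (P m * P n) = 0"
  shows "P n = smult (1 / lead_coeff (q n)) (q n)"
proof (rule eq_if_L_eq[of _ n])
  fix k assume "k \<le> n"
  have nz: "P k \<noteq> 0" for k
    using lead[of k] by auto
  show "L (P n * q k) = L (smult (1 / lead_coeff (q n)) (q n) * q k)"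
  proof (cases "k = n")
    case True
    then show ?thesis
      using lead[of n] by (simp add: L_q_same_degree deg L_smult orthonormal_q)
  next
    case False
    \<comment> \<open>Here \<open>P\<close> plays the role of the orthogonal sequence and
      \<open>q k\<close>, with \<open>k < n\<close>, that of the polynomial of lower degree.\<close>
    then have "L (q k * P n) = 0"
      using \<open>k \<le> n\<close> by (intro L_lower_degree[OF deg orth nz]) (simp_all add: degree_q)
    then show ?thesis
      using False by (simp add: L_smult orthonormal_q mult.commute)
  qed
qed (simp_all add: deg degree_q)

text \<open>Multiplication by x is symmetric for \<open>L\<close>, so pairing
  \<open>[:0, 1:] * q n\<close> with \<open>q k\<close> vanishes for \<open>k + 1 < n\<close>. The
  two neighbouring coefficients are found by comparing leading coefficients.\<close>

lemma three_term_recurrence: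
  "[:0, 1:] * q n =
     smult (lead_coeff (q n) / lead_coeff (q (n + 1))) (q (n + 1))
     + smult (L ([:0, 1:] * q n * q n)) (q n)
     + (if n = 0 then 0 else smult (lead_coeff (q (n - 1)) / lead_coeff (q n)) (q (n - 1)))"
    (is "?l = ?r")
proof (rule eq_if_L_eq[of _ "n + 1"])
  have deg_X: "degree ([:0, 1:] * q m) = m + 1" for m
    by (simp add: degree_q degree_pCons_eq)
  have coeff_X: "coeff ([:0, 1:] * q m) (m + 1) = lead_coeff (q m)" for m
    by (simp add: degree_q)
  show "degree ?l \<le> n + 1"
    using deg_X by simp
  show "degree ?r \<le> n + 1"
    by (intro degree_add_le) (auto simp: degree_q)
  fix k assume "k \<le> n + 1"
  define B where "B = L ([:0, 1:] * q n * q n)"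
  have R: "L (?r * q k) = (if k = n + 1 then lead_coeff (q n) / lead_coeff (q (n + 1)) else 0)
      + (if k = n then B else 0)
      + (if n \<noteq> 0 \<and> k = n - 1 then lead_coeff (q (n - 1)) / lead_coeff (q n) else 0)"
    unfolding B_def[symmetric] by (auto simp: distrib_right L_add L_smult orthonormal_q)
  have swap: "?l * q k = ([:0, 1:] * q k) * q n"
    by (simp only: mult_ac)
  consider "k = n + 1" | "k = n" | "n \<noteq> 0" "k = n - 1" | "k + 1 < n"
    using \<open>k \<le> n + 1\<close> by linarith
  then show "L (?l * q k) = L (?r * q k)"
  proof cases
    case 1
    then have "L (?l * q k) = lead_coeff (q n) / lead_coeff (q (n + 1))"
      using L_q_same_degree[of ?l "n + 1"] by (simp only: deg_X coeff_X)
    then show ?thesis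
      unfolding R using 1 by auto
  next
    case 2
    then show ?thesis
      unfolding R by (auto simp: B_def)
  next
    case 3
    then have "k + 1 = n"
      by simp
    then have "L (?l * q k) = lead_coeff (q k) / lead_coeff (q n)"
      unfolding swap using L_q_same_degree[of "[:0, 1:] * q k" n] deg_X[of k] coeff_X[of k]
      by (simp only:)
    then show ?thesis
      unfolding R using 3 by auto
  next
    case 4
    then have "L (?l * q k) = 0"
      unfolding swap by (intro L_q_lower) (simp only: deg_X)
    then show ?thesis
      unfolding R using 4 by auto
  qed
qed

end

section \<open>The modified functional\<close>

locale christoffel_functional =
  orthonormal_functional L p + modified: orthonormal_functional "\<lambda>f. L ([:- c, 1:]\<^sup>2 * f)" p2
  for L p c p2
begin

abbreviation "w \<equiv> [:- c, 1:]\<^sup>2"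

abbreviation "r n \<equiv> lead_coeff (p n)"

abbreviation "r2 n \<equiv> lead_coeff (p2 n)"

text \<open>The coefficient of \<open>p (n + 1)\<close> in the expansion of \<open>w * p2 n\<close>,
  the only one that leading coefficients alone do not give.\<close>

definition middle_coeff :: "nat \<Rightarrow> real" where
  "middle_coeff n = L (w * p2 n * p (n + 1))"

text \<open>Moving \<open>w\<close> into the functional turns this into a pairing of
  \<open>p k\<close> with \<open>p2 n\<close> for the modified functional.\<close>

lemma L_w_p2_p_lower: "k < n \<Longrightarrow> L (w * p2 n * p k) = 0"
  using modified.L_q_lower[of "p k" n] by (simp add: degree_q mult_ac)

lemma L_w_p2_p_same: "L (w * p2 n * p n) = r n / r2 n"
  using modified.L_q_same_degree[of "p n" n] by (simp add: degree_q mult_ac)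

lemma w_times_p2:
  "w * p2 n = smult (r2 n / r (n + 2)) (p (n + 2)) + smult (middle_coeff n) (p (n + 1))
    + smult (r n / r2 n) (p n)" (is "?l = ?r")
proof (rule eq_if_L_eq[of _ "n + 2"])
  have deg_w: "degree w = 2"
    by (simp add: degree_power_eq)
  have deg: "degree ?l = n + 2"
    by (subst degree_mult_eq) (auto simp: deg_w modified.degree_q)
  then show "degree ?l \<le> n + 2"
    by simp
  have lead: "coeff ?l (n + 2) = r2 n"
    using lead_coeff_mult[of w "p2 n"] unfolding deg by (simp add: lead_coeff_power)
  show "degree ?r \<le> n + 2"
    by (intro degree_add_le) (auto simp: degree_q)
  fix k assume "k \<le> n + 2"
  then consider "k = n + 2" | "k = n + 1" | "k = n" | "k < n"
    by linarith
  then show "L (?l * p k) = L (?r * p k)"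
  proof cases
    case 1
    then show ?thesis
      using L_q_same_degree[of ?l "n + 2"] deg lead
      by (simp add: distrib_right L_add L_smult orthonormal_q)
  next
    case 2
    then show ?thesis
      by (simp add: distrib_right L_add L_smult orthonormal_q middle_coeff_def)
  next
    case 3
    then show ?thesis
      by (simp add: distrib_right L_add L_smult orthonormal_q L_w_p2_p_same)
  next
    case 4
    then show ?thesis
      by (simp add: distrib_right L_add L_smult orthonormal_q L_w_p2_p_lower)
  qed
qed

lemma middle_coeff_eval:
  assumes "poly (p (n + 1)) c \<noteq> 0"
  shows "middle_coeff n =
    - (r2 n / r (n + 2) * (poly (p (n + 2)) c / poly (p (n + 1)) c)
       + r n / r2 n * (poly (p n) c / poly (p (n + 1)) c))"
proof -
  have "poly (w * p2 n) c = 0"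
    by simp
  then have "r2 n / r (n + 2) * poly (p (n + 2)) c + middle_coeff n * poly (p (n + 1)) c
      + r n / r2 n * poly (p n) c = 0"
    unfolding w_times_p2 by simp
  then have "middle_coeff n * poly (p (n + 1)) c =
      - (r2 n / r (n + 2) * poly (p (n + 2)) c + r n / r2 n * poly (p n) c)"
    by linarith
  then have "middle_coeff n =
      - (r2 n / r (n + 2) * poly (p (n + 2)) c + r n / r2 n * poly (p n) c) / poly (p (n + 1)) c"
    using assms by (metis nonzero_mult_div_cancel_right)
  then show ?thesis
    by (simp add: diff_divide_distrib)
qed

text \<open>The pairing of x times \<open>w * p2 n\<close> with \<open>p n\<close> is computed
  twice, once by the recurrence of \<open>p\<close> and once by that of \<open>p2\<close>. Equating
  the results determines the diagonal coefficient of the latter.\<close>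

lemma modified_recurrence_coeff:
  "L (w * ([:0, 1:] * p2 n * p2 n)) =
     L ([:0, 1:] * p n * p n) + r2 n / r (n + 1) * middle_coeff n
     - (if n = 0 then 0 else r2 (n - 1) / r n * middle_coeff (n - 1))"
proof -
  define K where "K = L (w * ([:0, 1:] * p2 n * p2 n))"
  define B where "B = L ([:0, 1:] * p n * p n)"
  have p_rec: "[:0, 1:] * p n = smult (r n / r (n + 1)) (p (n + 1)) + smult B (p n)
      + (if n = 0 then 0 else smult (r (n - 1) / r n) (p (n - 1)))"
    unfolding B_def by (rule three_term_recurrence)
  have p2_rec: "[:0, 1:] * p2 n = smult (r2 n / r2 (n + 1)) (p2 (n + 1)) + smult K (p2 n)
      + (if n = 0 then 0 else smult (r2 (n - 1) / r2 n) (p2 (n - 1)))"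
    unfolding K_def by (rule modified.three_term_recurrence)
  \<comment> \<open>The term with \<open>p (n - 1)\<close> drops out, its degree being below
    \<open>n\<close>.\<close>
  have "L (w * p2 n * ([:0, 1:] * p n)) = r n / r (n + 1) * middle_coeff n + B * (r n / r2 n)"
    unfolding p_rec
    by (simp add: distrib_left L_add L_smult middle_coeff_def L_w_p2_p_same L_w_p2_p_lower)
  \<comment> \<open>Now \<open>p2 (n + 1)\<close> drops out, and \<open>p2 (n - 1)\<close>
    contributes \<open>middle_coeff (n - 1)\<close> because \<open>p n\<close> is one index above
    it.\<close>
  moreover have "L (w * ([:0, 1:] * p2 n) * p n) = K * (r n / r2 n)
      + (if n = 0 then 0 else r2 (n - 1) / r2 n * middle_coeff (n - 1))"
    unfolding p2_rec
    by (simp add: distrib_left distrib_right L_add L_smult middle_coeff_def L_w_p2_p_same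
        L_w_p2_p_lower)
  moreover have "w * p2 n * ([:0, 1:] * p n) = w * ([:0, 1:] * p2 n) * p n"
    by (simp only: mult_ac)
  moreover define X where
    "X = (if n = 0 then 0 else r2 (n - 1) / r2 n * middle_coeff (n - 1))"
  ultimately have "K * (r n / r2 n) = r n / r (n + 1) * middle_coeff n + B * (r n / r2 n) - X"
    by simp
  moreover have nz: "r n \<noteq> 0" "r2 n \<noteq> 0"
    by simp_all
  ultimately have "K = (r n / r (n + 1) * middle_coeff n + B * (r n / r2 n) - X) / (r n / r2 n)"
    by (metis divide_eq_0_iff nonzero_mult_div_cancel_right)
  also have "\<dots> = B + r2 n / r (n + 1) * middle_coeff n - X / (r n / r2 n)"
    using nz by (simp add: field_simps)
  also have "X / (r n / r2 n) = (if n = 0 then 0 else r2 (n - 1) / r n * middle_coeff (n - 1))"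
    using nz by (simp add: X_def)
  finally show ?thesis
    by (simp only: K_def B_def)
qed

end

section \<open>Integration of polynomials\<close>

lemma poly_set_integrable:
  assumes "finite_moments M E"
  shows "set_integrable M E (poly f)"
proof -
  have "integrable M (\<lambda>x. \<Sum>i\<le>degree f. coeff f i *\<^sub>R (indicator E x *\<^sub>R x ^ i))"
    using assms unfolding finite_moments_def set_integrable_def
    by (intro Bochner_Integration.integrable_sum integrable_scaleR_right) blast
  then show ?thesis
    by (simp add: set_integrable_def poly_altdef sum_distrib_left mult_ac)
qed

lemma poly_functional_set_integral:
  assumes "finite_moments M E"
  shows "poly_functional (\<lambda>f. LINT x:E|M. poly f x)"
  by unfold_locales (simp_all add: poly_set_integrable[OF assms] set_integral_add)

lemma orthonormal_functional_set_integral: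
  assumes "finite_moments M E" "orthonormal_polys M E p"
  shows "orthonormal_functional (\<lambda>f. LINT x:E|M. poly f x) p"
proof -
  interpret poly_functional "\<lambda>f. LINT x:E|M. poly f x"
    using assms(1) by (rule poly_functional_set_integral)
  show ?thesis
  proof
    show "degree (p n) = n" "lead_coeff (p n) > 0" for n
      using assms(2) unfolding orthonormal_polys_def by blast+
    show "(LINT x:E|M. poly (p m * p n) x) = (if m = n then 1 else 0)" for m n
      using assms(2) by (simp only: orthonormal_polys_def poly_mult)
  qed
qed

text \<open>Identifies integration against the density with the modified functional; Borel
  measurability of \<open>E\<close> and of \<open>poly f\<close> justifies
  \<open>integral_density\<close>.\<close>

lemma christoffel2_set_integral:
  assumes "sets M = sets borel" "E \<in> sets borel"
  shows "(LINT x:E|christoffel2 c M. poly f x) = (LINT x:E|M. poly ([:- c, 1:]\<^sup>2 * f) x)"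
proof -
  note [measurable_cong] = assms(1)
  note [measurable] = assms(2)
  have [measurable]: "poly f \<in> borel_measurable borel"
    by (intro borel_measurable_continuous_onI continuous_intros)
  have "(LINT x:E|christoffel2 c M. poly f x) =
      (LINT x|M. (x - c)\<^sup>2 *\<^sub>R (indicator E x *\<^sub>R poly f x))"
    unfolding set_lebesgue_integral_def christoffel2_def
    by (intro integral_density) (auto simp: borel_measurable_scaleR)
  also have "\<dots> = (LINT x:E|M. poly ([:- c, 1:]\<^sup>2 * f) x)"
    unfolding set_lebesgue_integral_def
    by (intro Bochner_Integration.integral_cong) (auto simp: algebra_simps)
  finally show ?thesis .
qed

section \<open>Nonvanishing of the orthonormal polynomials outside the interval\<close>

lemma is_interval_one_sided:
  fixes E :: "real set"
  assumes "is_interval E" "c \<notin> E"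
  shows "(\<forall>x\<in>E. x < c) \<or> (\<forall>x\<in>E. c < x)"
  using assms unfolding is_interval_1 by (metis less_eq_real_def linorder_not_less)

lemma orthonormal_nonzero_outside_interval:
  assumes "is_interval E" "finite_moments M E" "c \<notin> E" "orthonormal_polys M E p"
  shows "poly (p n) c \<noteq> 0"
proof
  let ?L = "\<lambda>f. LINT x:E|M. poly f x"
  interpret orthonormal_functional ?L p
    using assms(2,4) by (rule orthonormal_functional_set_integral)
  assume "poly (p n) c = 0"
  then obtain g where g: "p n = [:- c, 1:] * g"
    by (auto simp: poly_eq_0_iff_dvd elim: dvdE)
  have "g \<noteq> 0"
    using q_nonzero[of n] g by auto
  then have "degree (p n) = 1 + degree g"
    unfolding g by (subst degree_mult_eq) auto
  then have "?L (g * p n) = 0"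
    by (intro L_q_lower) (simp add: degree_q)
  then have int0: "(LINT x|M. indicator E x * ((x - c) * (poly g x)\<^sup>2)) = 0"
    unfolding set_lebesgue_integral_def g by (simp add: algebra_simps power2_eq_square)
  have intg: "integrable M (\<lambda>x. indicator E x * ((x - c) * (poly g x)\<^sup>2))"
    using poly_set_integrable[OF assms(2), of "g * p n"]
    unfolding set_integrable_def g by (simp add: algebra_simps power2_eq_square)
  \<comment> \<open>An integrand of constant sign with zero integral vanishes almost
    everywhere.\<close>
  have "AE x in M. indicator E x * ((x - c) * (poly g x)\<^sup>2) = 0"
    using is_interval_one_sided[OF assms(1,3)]
  proof
    assume "\<forall>x\<in>E. c < x"
    then have "0 \<le> indicator E x * ((x - c) * (poly g x)\<^sup>2)" for x
      by (auto simp: indicator_def less_imp_le)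
    then show ?thesis
      using integral_nonneg_eq_0_iff_AE[OF intg] int0 by auto
  next
    assume "\<forall>x\<in>E. x < c"
    then have "0 \<le> - (indicator E x * ((x - c) * (poly g x)\<^sup>2))" for x
      by (auto simp: indicator_def mult_le_0_iff less_imp_le)
    then show ?thesis
      using integral_nonneg_eq_0_iff_AE[of M "\<lambda>x. - (indicator E x * ((x - c) * (poly g x)\<^sup>2))"]
        intg int0 by auto
  qed
  \<comment> \<open>Either factor vanishing makes \<open>p n\<close> vanish, so its squared norm
    would be 0 instead of 1.\<close>
  then have "AE x in M. indicator E x *\<^sub>R poly (p n * p n) x = 0"
    by eventually_elim (auto simp: g indicator_def)
  then have "?L (p n * p n) = 0"
    unfolding set_lebesgue_integral_def by (rule integral_eq_zero_AE)
  then show False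
    using orthonormal_q[of n n] by simp
qed

section \<open>The recurrence for the modified orthonormal polynomials\<close>

theorem corollary1:
  fixes \<mu> :: "real measure" and E :: "real set" and c :: real
    and P p p2 :: "nat \<Rightarrow> real poly"
    and \<beta> \<gamma> r r2 e d \<kappa> \<tau> :: "nat \<Rightarrow> real"
  assumes "sets \<mu> = sets borel"
    and "is_interval E"
    and "infinite (measure_support \<mu>)"
    and "measure_support \<mu> \<subseteq> E"
    and "finite_moments \<mu> E"
    and "c \<notin> E"
    and "monic_orthogonal_polys \<mu> E P"
    and "\<And>n x. x * poly (P n) x =
           poly (P (n + 1)) x + \<beta> n * poly (P n) x +
           (if n = 0 then 0 else \<gamma> n * poly (P (n - 1)) x)"
    and "orthonormal_polys \<mu> E p"
    and "orthonormal_polys (christoffel2 c \<mu>) E p2"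
    and "\<And>n. r n = lead_coeff (p n)"
    and "\<And>n. r2 n = lead_coeff (p2 n)"
    and "\<And>n. e n = (r n / r2 n)\<^sup>2"
    and "\<And>n. d n =
           r (n + 1) / r (n + 2) * (poly (p (n + 2)) c / poly (p (n + 1)) c) +
           (r n / r2 n)\<^sup>2 * (r (n + 1) / r n) * (poly (p n) c / poly (p (n + 1)) c)"
    and "\<And>n. \<tau> n = ((if n = 0 then 1 else r2 (n - 1)) / r2 n)\<^sup>2"
    and "\<And>n. \<kappa> n =
           (\<beta> n + (if n = 0 then 0 else \<gamma> n * (d (n - 1) / e (n - 1)))) * e n * (r2 n / r n)\<^sup>2
           - d n * (r2 n / r (n + 1))\<^sup>2"
  shows "(\<forall>n. poly (p n) c \<noteq> 0) \<and>
    (\<forall>n x. sqrt (\<tau> (n + 1)) * poly (p2 (n + 1)) x =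
       (x - \<kappa> n) * poly (p2 n) x - (if n = 0 then 0 else sqrt (\<tau> n) * poly (p2 (n - 1)) x)) \<and>
    (\<forall>x. poly (p2 0) x = 1 / sqrt (\<tau> 0)) \<and>
    \<tau> 0 = (LINT x:E|\<mu>. (x - c)\<^sup>2) \<and>
    (\<forall>n. \<kappa> n =
       \<beta> n
       + (if n = 0 then 0 else
            \<gamma> n * ((r2 (n - 1) / r (n - 1))\<^sup>2 * (r n / r (n + 1)) * (poly (p (n + 1)) c / poly (p n) c)
                   + r n / r (n - 1) * (poly (p (n - 1)) c / poly (p n) c)))
       - (r2 n / r (n + 1) * (r2 n / r (n + 2)) * (poly (p (n + 2)) c / poly (p (n + 1)) c)
          + r n / r (n + 1) * (poly (p n) c / poly (p (n + 1)) c))) \<and>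
    (\<forall>n. \<tau> n > 0) \<and> (\<forall>n. e n > 0)"
proof -
  note r_eq = assms(11) and r2_eq = assms(12) and e_eq = assms(13) and d_eq = assms(14)
    and \<tau>_eq = assms(15) and \<kappa>_eq = assms(16)
  define L where "L = (\<lambda>f. LINT x:E|\<mu>. poly f x)"
  have E: "E \<in> sets borel"
    using assms(2) by (rule real_interval_borel_measurable)
  interpret christoffel_functional L p c p2
  proof -
    interpret orthonormal_functional L p
      unfolding L_def using assms(5,9) by (rule orthonormal_functional_set_integral)
    show "christoffel_functional L p c p2"
    proof
      show "degree (p2 n) = n" "lead_coeff (p2 n) > 0" for n
        using assms(10) unfolding orthonormal_polys_def by blast+
      show "L ([:- c, 1:]\<^sup>2 * (p2 m * p2 n)) = (if m = n then 1 else 0)" for m n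
      proof -
        have "L ([:- c, 1:]\<^sup>2 * (p2 m * p2 n)) =
            (LINT x:E|christoffel2 c \<mu>. poly (p2 m * p2 n) x)"
          unfolding L_def by (rule christoffel2_set_integral[OF assms(1) E, symmetric])
        then show ?thesis
          using assms(10) by (simp only: orthonormal_polys_def poly_mult)
      qed
      show "L ([:- c, 1:]\<^sup>2 * (f + g)) = L ([:- c, 1:]\<^sup>2 * f) + L ([:- c, 1:]\<^sup>2 * g)" for f g
        by (simp only: distrib_left L_add)
      show "L ([:- c, 1:]\<^sup>2 * smult a f) = a * L ([:- c, 1:]\<^sup>2 * f)" for a f
        by (simp only: mult_smult_right L_smult)
    qed
  qed
  have pos: "r n > 0" "r2 n > 0" for n
    unfolding r_eq r2_eq by (rule lead_coeff_q modified.lead_coeff_q)+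
  then have nz: "r n \<noteq> 0" "r2 n \<noteq> 0" for n
    by (simp_all add: less_imp_neq[symmetric])
  have p_nz: "poly (p n) c \<noteq> 0" for n
    using assms(2,5,6,9) by (rule orthonormal_nonzero_outside_interval)

  have P: "P n = smult (1 / r n) (p n)" for n
    unfolding r_eq
  proof (rule monic_orthogonal_eq)
    show "degree (P n) = n" "lead_coeff (P n) = 1" for n
      using assms(7) unfolding monic_orthogonal_polys_def by blast+
    show "L (P m * P n) = 0" if "m \<noteq> n" for m n
    proof -
      have "(LINT x:E|\<mu>. poly (P m * P n) x) = 0"
        using assms(7) that unfolding monic_orthogonal_polys_def poly_mult by blast
      then show ?thesis
        by (simp only: L_def)
    qed
  qed
  \<comment> \<open>Real polynomials with equal values everywhere are equal, so the pointwise
    recurrence can be fed to \<open>L\<close>.\<close>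
  have P_rec: "[:0, 1:] * P n = P (n + 1) + smult (\<beta> n) (P n)
      + (if n = 0 then 0 else smult (\<gamma> n) (P (n - 1)))" for n
  proof -
    have "poly ([:0, 1:] * P n) x = poly (P (n + 1) + smult (\<beta> n) (P n)
      + (if n = 0 then 0 else smult (\<gamma> n) (P (n - 1)))) x" for x
      using assms(8)[of x n] by auto
    then show ?thesis
      by (simp only: flip: poly_eq_poly_eq_iff) blast
  qed
  \<comment> \<open>Pairing with \<open>p k\<close> isolates one coefficient at a time, since each
    \<open>P m\<close> is \<open>p m\<close> divided by \<open>r m\<close>.\<close>
  have L_P_rec: "L ([:0, 1:] * p n * p k) / r n = (if k = n + 1 then 1 / r (n + 1) else 0)
      + (if k = n then \<beta> n / r n else 0)
      + (if n \<noteq> 0 \<and> k = n - 1 then \<gamma> n / r (n - 1) else 0)" for n k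
  proof -
    have "L ([:0, 1:] * P n * p k) = (if k = n + 1 then 1 / r (n + 1) else 0)
      + (if k = n then \<beta> n / r n else 0)
      + (if n \<noteq> 0 \<and> k = n - 1 then \<gamma> n / r (n - 1) else 0)"
      unfolding P_rec unfolding P
      by (auto simp: distrib_right L_add L_smult orthonormal_q)
    moreover have "L ([:0, 1:] * P n * p k) = L ([:0, 1:] * p n * p k) / r n"
      unfolding P mult_smult_left mult_smult_right L_smult by simp
    ultimately show ?thesis
      by (simp only:)
  qed
  have \<beta>: "\<beta> n = L ([:0, 1:] * p n * p n)" for n
    using L_P_rec[of n n] nz(1)[of n] by (cases n) auto
  have p_rec: "[:0, 1:] * p n = smult (r n / r (n + 1)) (p (n + 1)) + smult (\<beta> n) (p n)
      + (if n = 0 then 0 else smult (r (n - 1) / r n) (p (n - 1)))" for n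
    using three_term_recurrence[of n] by (simp only: \<beta> r_eq)
  \<comment> \<open>The same pairing, with \<open>k = n - 1\<close>, is evaluated by the orthonormal
    and by the monic recurrence.\<close>
  have \<gamma>: "\<gamma> n = (r (n - 1) / r n)\<^sup>2" if "n \<noteq> 0" for n
  proof -
    have "L ([:0, 1:] * p n * p (n - 1)) = r (n - 1) / r n"
      using that unfolding p_rec
      by (auto simp: distrib_right L_add L_smult orthonormal_q)
    then show ?thesis
      using L_P_rec[of n "n - 1"] that nz(1)[of n] nz(1)[of "n - 1"]
      by (cases n) (auto simp: field_simps power2_eq_square)
  qed

  \<comment> \<open>Up to a factor, \<open>d\<close> is the middle coefficient already evaluated at
    \<open>c\<close>.\<close>
  have d: "d n = - (r (n + 1) / r2 n * middle_coeff n)" for n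
    using nz(1)[of n] nz(1)[of "n + 1"] nz(1)[of "n + 2"] nz(2)[of n] p_nz[of "n + 1"]
    unfolding d_eq middle_coeff_eval[OF p_nz, folded r_eq r2_eq]
    by (simp add: field_simps power2_eq_square)
  have e_cancel: "e n * (r2 n / r n)\<^sup>2 = 1" for n
    using nz(1)[of n] nz(2)[of n] by (simp add: e_eq power_divide)
  have \<kappa>_short: "\<kappa> n = \<beta> n + (if n = 0 then 0 else \<gamma> n * (d (n - 1) / e (n - 1)))
      - d n * (r2 n / r (n + 1))\<^sup>2" for n
    by (simp only: \<kappa>_eq mult.assoc e_cancel mult_1_right)
  \<comment> \<open>With \<open>d\<close>, \<open>e\<close> and \<open>\<gamma>\<close> substituted,
    the definition of \<open>\<kappa>\<close> agrees term by term with
    \<open>modified_recurrence_coeff\<close>.\<close>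
  have \<kappa>: "\<kappa> n = L ([:- c, 1:]\<^sup>2 * ([:0, 1:] * p2 n * p2 n))" for n
  proof -
    have "d n * (r2 n / r (n + 1))\<^sup>2 = - (r2 n / r (n + 1) * middle_coeff n)"
      unfolding d using nz(1)[of "n + 1"] nz(2)[of n]
      by (simp add: field_simps power2_eq_square)
    moreover have "\<gamma> n * (d (n - 1) / e (n - 1)) = - (r2 (n - 1) / r n * middle_coeff (n - 1))"
      if "n \<noteq> 0"
      using that nz(1)[of n] nz(1)[of "n - 1"] nz(2)[of "n - 1"]
      by (simp add: d \<gamma> e_eq field_simps power2_eq_square)
    ultimately show ?thesis
      unfolding \<kappa>_short modified_recurrence_coeff[folded r_eq r2_eq] \<beta> by auto
  qed
  \<comment> \<open>Positive leading coefficients let the root undo the square. Hence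
    \<open>sqrt (\<tau> (n + 1))\<close> is the upper coefficient in the recurrence of
    \<open>p2\<close>, and the default 1 matters only at \<open>n = 0\<close>.\<close>
  have sqrt_\<tau>: "sqrt (\<tau> n) = (if n = 0 then 1 else r2 (n - 1)) / r2 n" for n
    using pos(2)[of n] pos(2)[of "n - 1"] unfolding \<tau>_eq real_sqrt_abs by simp

  have "sqrt (\<tau> (n + 1)) * poly (p2 (n + 1)) x =
      (x - \<kappa> n) * poly (p2 n) x - (if n = 0 then 0 else sqrt (\<tau> n) * poly (p2 (n - 1)) x)" for n x
    using arg_cong[OF modified.three_term_recurrence[of n], of "\<lambda>f. poly f x"]
    unfolding sqrt_\<tau> \<kappa>[symmetric] r2_eq[symmetric] by (auto simp: algebra_simps)
  moreover have p2_0: "p2 0 = [:r2 0:]"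
    using modified.degree_q[of 0] by (auto simp: r2_eq elim: degree_eq_zeroE)
  then have "poly (p2 0) x = 1 / sqrt (\<tau> 0)" for x
    by (simp add: sqrt_\<tau>)
  \<comment> \<open>The constant \<open>p2 0\<close> has norm 1, so the total weighted mass is the
    inverse square of \<open>r2 0\<close>.\<close>
  moreover have "\<tau> 0 = (LINT x:E|\<mu>. (x - c)\<^sup>2)"
  proof -
    have "w * (p2 0 * p2 0) = smult ((r2 0)\<^sup>2) w"
      by (simp add: p2_0 power2_eq_square)
    then have "(r2 0)\<^sup>2 * L w = 1"
      using modified.orthonormal_q[of 0 0] by (simp only: L_smult refl if_True)
    then have "L w = \<tau> 0"
      using nz(2)[of 0] by (simp add: \<tau>_eq field_simps)
    moreover have "poly w = (\<lambda>x. (x - c)\<^sup>2)"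
      by (simp add: fun_eq_iff)
    ultimately show ?thesis
      by (simp add: L_def)
  qed
  moreover have "\<kappa> n =
       \<beta> n
       + (if n = 0 then 0 else
            \<gamma> n * ((r2 (n - 1) / r (n - 1))\<^sup>2 * (r n / r (n + 1)) * (poly (p (n + 1)) c / poly (p n) c)
                   + r n / r (n - 1) * (poly (p (n - 1)) c / poly (p n) c)))
       - (r2 n / r (n + 1) * (r2 n / r (n + 2)) * (poly (p (n + 2)) c / poly (p (n + 1)) c)
          + r n / r (n + 1) * (poly (p n) c / poly (p (n + 1)) c))" for n
  proof -
    have "d m / e m = (r2 m / r m)\<^sup>2 * (r (m + 1) / r (m + 2)) * (poly (p (m + 2)) c / poly (p (m + 1)) c)
        + r (m + 1) / r m * (poly (p m) c / poly (p (m + 1)) c)" for m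
      using nz(1)[of m] nz(2)[of m] unfolding d_eq e_eq
      by (simp add: field_simps power2_eq_square)
    \<comment> \<open>Case distinction on \<open>n\<close> turns the indices
      \<open>n - 1 + 1\<close> and \<open>n - 1 + 2\<close> into \<open>n\<close> and
      \<open>n + 1\<close>.\<close>
    from this[of "n - 1"] have "n \<noteq> 0 \<Longrightarrow> d (n - 1) / e (n - 1) =
        (r2 (n - 1) / r (n - 1))\<^sup>2 * (r n / r (n + 1)) * (poly (p (n + 1)) c / poly (p n) c)
        + r n / r (n - 1) * (poly (p (n - 1)) c / poly (p n) c)"
      by (cases n) simp_all
    moreover have "d n * (r2 n / r (n + 1))\<^sup>2 =
        r2 n / r (n + 1) * (r2 n / r (n + 2)) * (poly (p (n + 2)) c / poly (p (n + 1)) c)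
        + r n / r (n + 1) * (poly (p n) c / poly (p (n + 1)) c)"
      using nz(1)[of n] nz(1)[of "n + 1"] nz(2)[of n] unfolding d_eq
      by (simp add: field_simps power2_eq_square)
    ultimately show ?thesis
      unfolding \<kappa>_short by simp
  qed
  moreover have "\<tau> n > 0" "e n > 0" for n
    using nz(1)[of n] nz(2)[of n] nz(2)[of "n - 1"] by (simp_all add: \<tau>_eq e_eq)
  ultimately show ?thesis
    using p_nz by blast
qed

end
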